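(* Assume that $H>\frac12$ (with $H<1$), let $\sigma>0$ and $Z_0>0$ be constants, and let $(W_t^H)_{t\ge0}$ be a fractional Brownian motion with Hurst parameter $H$. Let $f:[0,\infty)\times[0,\infty)\to\mathbb{R}$ be a continuous function satisfying conditions (D1) and (D2) (stated in the context). Then the process $(Z_t)_{t\ge0}$ defined by $$dZ_t=\frac{f(t,Z_t)}{2Z_t}\,dt+\frac{\sigma}{2}\,dW_t^H$$ with initial value $Z_0$ is strictly positive everywhere almost surely; that is, $\mathbb{P}(\tau=\infty)=1$, where $\tau=\inf\{t\ge0:Z_t=0\}$.
   Context: Condition (D1) on $f$: the function $g:[0,\infty)\times(0,\infty)\to(-\infty,\infty)$ defined by $g(t,x)=f(t,x)/(2x)$ is continuous and admits a continuous partial derivative with respect to $x$ on $(0,\infty)$; in addition, there exists a number $x^*>0$ such that for every $x>x^*$, $g(t,x)<0$ for all $t\ge 0$. Condition (D2) on $f$: for any $T>0$ there exists $x_T>0$ such that $f(t,x)>0$ for all $0<t\le T$ and $0\le x\le x_T$. The fractional Brownian motion starts at $W_0^H=0$ and has almost surely continuous sample paths. The equation is understood pathwise in integral form: almost surely, $Z_t=Z_0+\frac12\int_0^t f(s,Z_s)Z_s^{-1}\,ds+\frac{\sigma}{2}W_t^H$ for $0\le t<\tau$ (with $\inf\emptyset=+\infty$). Under (D1) this equation has a unique solution which is continuous and positive up to the time $\tau$ of the first visit to $0$; $(Z_t)$ denotes this solution. *)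

theory Defs
  imports "HOL-Probability.Probability"
begin

text \<open>Point masses count as (degenerate) Gaussian laws; \<^const>\<open>normal_density\<close> is only a
  probability density for positive standard deviation, so they are a separate case.\<close>

definition gaussian_rv :: "'a measure \<Rightarrow> ('a \<Rightarrow> real) \<Rightarrow> bool" where
  "gaussian_rv M X \<longleftrightarrow>
     (\<exists>\<mu> s. s > 0 \<and> distributed M lborel X (\<lambda>x. ennreal (normal_density \<mu> s x))) \<or>
     (\<exists>\<mu>. X \<in> borel_measurable M \<and> (AE \<omega> in M. X \<omega> = \<mu>))"

definition gaussian_process :: "'a measure \<Rightarrow> 'i set \<Rightarrow> ('i \<Rightarrow> 'a \<Rightarrow> real) \<Rightarrow> bool" where
  "gaussian_process M T X \<longleftrightarrow>
     (\<forall>I c. finite I \<and> I \<subseteq> T \<longrightarrow> gaussian_rv M (\<lambda>\<omega>. \<Sum>t\<in>I. c t * X t \<omega>))"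

definition fractional_brownian_motion ::
    "'a measure \<Rightarrow> real \<Rightarrow> (real \<Rightarrow> 'a \<Rightarrow> real) \<Rightarrow> bool" where
  "fractional_brownian_motion M H W \<longleftrightarrow>
     gaussian_process M {0..} W \<and>
     (\<forall>t\<ge>0. (LINT \<omega>|M. W t \<omega>) = 0) \<and>
     (\<forall>s\<ge>0. \<forall>t\<ge>0. (LINT \<omega>|M. W s \<omega> * W t \<omega>) =
        (s powr (2 * H) + t powr (2 * H) - \<bar>t - s\<bar> powr (2 * H)) / 2) \<and>
     (AE \<omega> in M. W 0 \<omega> = 0) \<and>
     (AE \<omega> in M. continuous_on {0..} (\<lambda>t. W t \<omega>))"

text \<open>In the following two conditions only the values of \<open>f\<close> on \<open>[0,\<infinity>) \<times> [0,\<infinity>)\<close> matter.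
  The partial derivative is required to be jointly continuous in \<open>(t, x)\<close>.\<close>

definition condition_D1 :: "(real \<Rightarrow> real \<Rightarrow> real) \<Rightarrow> bool" where
  "condition_D1 f \<longleftrightarrow>
     (let g = (\<lambda>t x. f t x / (2 * x)) in
       continuous_on ({0..} \<times> {0<..}) (\<lambda>(t, x). g t x) \<and>
       (\<exists>g'. (\<forall>t\<ge>0. \<forall>x>0. (g t has_real_derivative g' t x) (at x)) \<and>
             continuous_on ({0..} \<times> {0<..}) (\<lambda>(t, x). g' t x)) \<and>
       (\<exists>x_star>0. \<forall>x>x_star. \<forall>t\<ge>0. g t x < 0))"

definition condition_D2 :: "(real \<Rightarrow> real \<Rightarrow> real) \<Rightarrow> bool" where
  "condition_D2 f \<longleftrightarrow>
     (\<forall>T>0. \<exists>x_T>0. \<forall>t x. 0 < t \<and> t \<le> T \<and> 0 \<le> x \<and> x \<le> x_T \<longrightarrow> f t x > 0)"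

text \<open>The infimum is taken in \<^typ>\<open>ereal\<close>, so that it is \<open>\<infinity>\<close> for a path that never vanishes.\<close>

definition hitting_time_zero :: "(real \<Rightarrow> real) \<Rightarrow> ereal" where
  "hitting_time_zero z = (INF t\<in>{t. 0 \<le> t \<and> z t = 0}. ereal t)"

text \<open>A path \<open>z\<close> solves \<open>dz = f(t, z) / (2 z) dt + (\<sigma> / 2) dw\<close> started at \<open>z0\<close>, up to its first
  visit to 0. Its values after that visit are left unspecified. Continuity is required up to and
  including the time of the visit, and this time must be an actual zero of \<open>z\<close> if it is finite;
  otherwise an arbitrary jump of \<open>z\<close> to 0 would count as a visit. For \<open>t\<close> before the visit the
  integrand is continuous on \<open>{0..t}\<close>, so the integral is an ordinary Riemann integral.\<close>

definition solves_until_zero ::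
    "(real \<Rightarrow> real \<Rightarrow> real) \<Rightarrow> real \<Rightarrow> real \<Rightarrow> (real \<Rightarrow> real) \<Rightarrow> (real \<Rightarrow> real) \<Rightarrow> bool" where
  "solves_until_zero f \<sigma> z0 w z \<longleftrightarrow>
     (let \<tau> = hitting_time_zero z in
       z 0 = z0 \<and>
       continuous_on {t. 0 \<le> t \<and> ereal t \<le> \<tau>} z \<and>
       (\<forall>t. \<tau> = ereal t \<longrightarrow> z t = 0) \<and>
       (\<forall>t\<ge>0. ereal t < \<tau> \<longrightarrow> z t > 0) \<and>
       (\<forall>t\<ge>0. ereal t < \<tau> \<longrightarrow>
          z t = z0 + 1 / 2 * integral {0..t} (\<lambda>s. f s (z s) / z s) + \<sigma> / 2 * w t))"

end

theory Submission
  imports Defs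
begin

text \<open>The argument is pathwise, and the property of the noise behind it is Hoelder
  continuity of some order \<open>\<alpha> > 1 / 2\<close>. If the solution reached 0 at a finite time \<open>T\<close>, then the
  noise would have to pull it there against the drift \<open>f(t, z) / (2 z)\<close>, which is at least a
  positive multiple of \<open>1 / z\<close> near \<open>T\<close> by (D2). At distance \<open>h\<close> from \<open>T\<close> the noise moves by
  \<open>O(h powr \<alpha>)\<close>, so \<open>z\<close> is of that size at most; the drift then contributes at least a multiple of
  \<open>h powr (1 - \<alpha>)\<close>, which is more than the noise can offset, since \<open>1 - \<alpha> < \<alpha>\<close>. This is
  \<open>singular_drift_excludes_zero\<close>.

  Paths of fractional Brownian motion are Hoelder continuous of every order below \<open>H\<close>
  (\<open>fbm_holder\<close>), and \<open>H > 1 / 2\<close> leaves room for an \<open>\<alpha>\<close> between \<open>1 / 2\<close> and \<open>H\<close>. The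
  regularity comes from the Kolmogorov-Chentsov criterion (\<open>kolmogorov_chentsov\<close>), applied to the
  even moments of the Gaussian increments (\<open>gaussian_rv_even_moment\<close>), and rests on a
  deterministic chaining argument along dyadic grids
  (\<open>dyadic_increments_imp_holder\<close>).\<close>

section \<open>From dyadic increments to Hoelder continuity\<close>

text \<open>Chaining. Write \<open>r = 2 powr - \<alpha>\<close>, so that \<open>r ^ n\<close> is \<open>(2 powr - n) powr \<alpha>\<close>. Rounding \<open>t\<close> down
  to the grids of mesh \<open>1 / 2 ^ n\<close>, \<open>n \<ge> m\<close>, gives a sequence that tends to \<open>t\<close> and moves by at
  most one cell of the finer grid in each step. Summing the bounds on these moves is summing a
  geometric series, so replacing \<open>t\<close> by its rounding at level \<open>m\<close> costs \<open>O(r ^ m)\<close>. Two points at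
  distance at most \<open>1 / 2 ^ m\<close> round to equal or neighbouring points at level \<open>m\<close>.\<close>

lemma dyadic_increments_imp_holder:
  fixes w :: "real \<Rightarrow> real" and N n0 :: nat
  assumes \<alpha>: "\<alpha> > 0" and cont: "continuous_on {0..real N} w"
    and incr: "\<And>n k. n \<ge> n0 \<Longrightarrow> k < N * 2 ^ n \<Longrightarrow>
      \<bar>w (real (Suc k) / 2 ^ n) - w (real k / 2 ^ n)\<bar> \<le> (2 powr - \<alpha>) ^ n"
  shows "\<exists>K. \<forall>s\<in>{0..real N}. \<forall>t\<in>{0..real N}. \<bar>w t - w s\<bar> \<le> K * \<bar>t - s\<bar> powr \<alpha>"
proof -
  define r where "r = 2 powr - \<alpha>"
  have r: "0 < r" "r < 1" using \<alpha> by (auto simp: r_def powr_less_one)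
  define q where "q n t = nat \<lfloor>t * 2 ^ n\<rfloor>" for n :: nat and t :: real
  define d where "d n t = real (q n t) / 2 ^ n" for n t
  have q_bounds: "real (q n t) \<le> t * 2 ^ n" "t * 2 ^ n < real (q n t) + 1" if "t \<ge> 0" for n t
    using that by (auto simp: q_def of_nat_nat)
  have d_bounds: "d n t \<le> t" "t < d n t + 1 / 2 ^ n" "0 \<le> d n t" if "t \<ge> 0" for n t
    using q_bounds[OF that, of n] by (auto simp: d_def field_simps)
  \<comment> \<open>Refining the grid leaves the rounded point fixed or moves it right by one cell of the finer grid.\<close>
  have step: "\<bar>w (d (Suc n) t) - w (d n t)\<bar> \<le> r ^ Suc n"
    if "n \<ge> n0" "t \<in> {0..real N}" for n t
  proof -
    have t: "t \<ge> 0" "t \<le> N" using that by auto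
    have "real (2 * q n t) < real (q (Suc n) t + 1)" "real (q (Suc n) t) < real (2 * q n t + 2)"
      using q_bounds[OF t(1), of n] q_bounds[OF t(1), of "Suc n"] by (auto simp: algebra_simps)
    then consider "q (Suc n) t = 2 * q n t" | "q (Suc n) t = Suc (2 * q n t)"
      unfolding of_nat_less_iff by linarith
    then show ?thesis
    proof cases
      case 1
      then have "d (Suc n) t = d n t" by (simp add: d_def)
      then show ?thesis using r by simp
    next
      case 2
      have "real (Suc (2 * q n t)) \<le> t * 2 ^ Suc n" using q_bounds(1)[OF t(1), of "Suc n"] 2 by simp
      also have "\<dots> \<le> real N * 2 ^ Suc n" using t by (intro mult_right_mono) auto
      finally have "real (Suc (2 * q n t)) \<le> real (N * 2 ^ Suc n)" by simp
      then have "2 * q n t < N * 2 ^ Suc n" unfolding of_nat_le_iff by linarith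
      moreover have "d n t = real (2 * q n t) / 2 ^ Suc n" by (simp add: d_def)
      moreover have "d (Suc n) t = real (Suc (2 * q n t)) / 2 ^ Suc n" by (simp only: d_def 2)
      ultimately show ?thesis using incr[of "Suc n" "2 * q n t"] that by (simp add: r_def)
    qed
  qed
  have chain: "\<bar>w (d (m + j) t) - w (d m t)\<bar> \<le> r ^ m * (1 - r ^ j) / (1 - r)"
    if "m \<ge> n0" "t \<in> {0..real N}" for m j t
  proof (induction j)
    case (Suc j)
    have "\<bar>w (d (m + Suc j) t) - w (d m t)\<bar>
        \<le> \<bar>w (d (Suc (m + j)) t) - w (d (m + j) t)\<bar> + \<bar>w (d (m + j) t) - w (d m t)\<bar>"
      by simp
    also have "\<dots> \<le> r ^ Suc (m + j) + r ^ m * (1 - r ^ j) / (1 - r)"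
      using step[of "m + j" t] Suc that by (intro add_mono) auto
    also have "r ^ Suc (m + j) \<le> r ^ (m + j)" using r by (simp add: mult_left_le_one_le)
    also have "r ^ (m + j) + r ^ m * (1 - r ^ j) / (1 - r) = r ^ m * (1 - r ^ Suc j) / (1 - r)"
      using r by (simp add: field_simps power_add)
    finally show ?case by simp
  qed simp
  have approx: "\<bar>w t - w (d m t)\<bar> \<le> r ^ m / (1 - r)" if "m \<ge> n0" "t \<in> {0..real N}" for m t
  proof -
    have t: "t \<ge> 0" "t \<le> N" using that by auto
    have "(\<lambda>j. (1 / 2 :: real) ^ j) \<longlonglongrightarrow> 0" by (rule LIMSEQ_power_zero) simp
    then have "(\<lambda>j. (1 / 2 :: real) ^ (j + m)) \<longlonglongrightarrow> 0" by (rule LIMSEQ_ignore_initial_segment)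
    then have "(\<lambda>j. t - (1 / 2) ^ (j + m)) \<longlonglongrightarrow> t"
      using tendsto_diff[OF tendsto_const[of t]] by fastforce
    then have "(\<lambda>j. d (m + j) t) \<longlonglongrightarrow> t"
    proof (rule tendsto_sandwich[rotated 2])
      show "\<forall>\<^sub>F j in sequentially. t - (1 / 2) ^ (j + m) \<le> d (m + j) t"
        using d_bounds(2)[OF t(1)] by (intro always_eventually allI)
          (simp add: power_divide add.commute algebra_simps less_imp_le)
    qed (use d_bounds[OF t(1)] in auto)
    moreover have "d (m + j) t \<in> {0..real N}" for j
      using d_bounds(1,3)[OF t(1), of "m + j"] t by auto
    ultimately have "(\<lambda>j. w (d (m + j) t)) \<longlonglongrightarrow> w t"
      using cont that(2) by (auto simp: continuous_on_sequentially o_def)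
    then have "(\<lambda>j. \<bar>w (d (m + j) t) - w (d m t)\<bar>) \<longlonglongrightarrow> \<bar>w t - w (d m t)\<bar>"
      by (intro tendsto_intros)
    \<comment> \<open>Continuity of \<open>w\<close> is what carries the bound from the grid points to \<open>t\<close> itself.\<close>
    then show ?thesis
    proof (rule LIMSEQ_le_const2)
      have "r ^ m * (1 - r ^ j) / (1 - r) \<le> r ^ m / (1 - r)" for j
        using r by (intro divide_right_mono) (auto simp: mult_left_le)
      then show "\<exists>N. \<forall>j\<ge>N. \<bar>w (d (m + j) t) - w (d m t)\<bar> \<le> r ^ m / (1 - r)"
        using chain[OF that] order_trans by blast
    qed
  qed
  define C where "C = 1 + 2 / (1 - r)"
  have C: "C \<ge> 0" using r by (simp add: C_def)
  have modulus: "\<bar>w t - w s\<bar> \<le> C * r ^ m"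
    if "m \<ge> n0" "0 \<le> s" "s \<le> t" "t \<le> real N" "t - s \<le> 1 / 2 ^ m" for m s t
  proof -
    have t: "t \<ge> 0" and mem: "s \<in> {0..real N}" "t \<in> {0..real N}" using that by auto
    have ts: "t * 2 ^ m \<le> s * 2 ^ m + 1" "s * 2 ^ m \<le> t * 2 ^ m"
      using that by (auto simp: field_simps)
    have "real (q m t) < real (q m s + 2)" "real (q m s) < real (q m t + 1)"
      using q_bounds[OF t, of m] q_bounds[OF that(2), of m] ts
      unfolding of_nat_add of_nat_numeral of_nat_1 by linarith+
    then consider "q m t = q m s" | "q m t = Suc (q m s)"
      unfolding of_nat_less_iff by linarith
    then have "\<bar>w (d m t) - w (d m s)\<bar> \<le> r ^ m"
    proof cases
      case 1
      then show ?thesis using r by (simp add: d_def)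
    next
      case 2
      have "real (Suc (q m s)) \<le> t * 2 ^ m" using q_bounds(1)[OF t, of m] 2 by simp
      also have "\<dots> \<le> real N * 2 ^ m" using that by (intro mult_right_mono) auto
      finally have "real (Suc (q m s)) \<le> real (N * 2 ^ m)" by simp
      then have "q m s < N * 2 ^ m" unfolding of_nat_le_iff by linarith
      then show ?thesis using incr[OF that(1)] by (simp only: d_def 2 r_def)
    qed
    then have "\<bar>w t - w s\<bar> \<le> r ^ m / (1 - r) + r ^ m + r ^ m / (1 - r)"
      using approx[OF that(1) mem(1)] approx[OF that(1) mem(2)] by linarith
    also have "\<dots> = C * r ^ m" by (simp add: C_def algebra_simps)
    finally show ?thesis .
  qed
  have r_pow: "r ^ m = (1 / 2 ^ m) powr \<alpha>" for m :: nat
  proof -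
    have "r ^ m = 2 powr (- \<alpha> * real m)"
      by (simp add: r_def powr_powr flip: powr_realpow)
    also have "\<dots> = (2 powr - real m) powr \<alpha>" by (simp add: powr_powr mult.commute)
    finally show ?thesis by (simp add: powr_minus powr_realpow divide_inverse)
  qed
  have "bounded (w ` {0..real N})"
    using compact_continuous_image[OF cont] by (intro compact_imp_bounded) simp
  then obtain B where "\<forall>x\<in>w ` {0..real N}. norm x \<le> B" unfolding bounded_iff by blast
  then have B: "\<bar>w x\<bar> \<le> B" if "x \<in> {0..real N}" for x using that by simp
  have "B \<ge> 0" using B[of 0] by auto
  \<comment> \<open>The first summand serves pairs closer than \<open>1 / 2 ^ n0\<close>. Nothing is known about the increments
    on coarser grids, so the second one serves distant pairs through the bound \<open>B\<close> on the path.\<close>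
  define K where "K = C * 2 powr \<alpha> + 2 * B * (2 ^ n0) powr \<alpha>"
  have ordered: "\<bar>w t - w s\<bar> \<le> K * \<bar>t - s\<bar> powr \<alpha>" if "0 \<le> s" "s < t" "t \<le> real N" for s t
  proof (cases "t - s \<le> 1 / 2 ^ n0")
    case True
    have "\<exists>m. (1 / 2) ^ m < t - s" using that real_arch_pow_inv[of "t - s" "1 / 2"] by simp
    then have ex: "\<exists>m. 1 / 2 ^ m < t - s" by (simp add: power_divide)
    define m where "m = (LEAST m. 1 / 2 ^ m < t - s)"
    have m: "1 / 2 ^ m < t - s" unfolding m_def using ex by (rule LeastI_ex)
    have m0: "m > n0"
    proof (rule ccontr)
      assume "\<not> n0 < m"
      then have "(1 :: real) / 2 ^ n0 \<le> 1 / 2 ^ m"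
        by (intro divide_left_mono power_increasing) auto
      then show False using m True by linarith
    qed
    then obtain l where l: "m = Suc l" "l \<ge> n0" by (cases m) auto
    have "\<not> 1 / 2 ^ l < t - s"
      using not_less_Least[of l "\<lambda>m. 1 / 2 ^ m < t - s"] l by (simp add: m_def)
    then have "\<bar>w t - w s\<bar> \<le> C * r ^ l" using modulus[of l s t] that l by auto
    also have "r ^ l = (2 * (1 / 2 ^ m)) powr \<alpha>" by (simp add: r_pow l)
    also have "\<dots> \<le> (2 * (t - s)) powr \<alpha>" using m \<alpha> by (intro powr_mono2) auto
    also have "\<dots> = 2 powr \<alpha> * \<bar>t - s\<bar> powr \<alpha>" by (subst powr_mult) (use that in auto)
    finally have "\<bar>w t - w s\<bar> \<le> C * 2 powr \<alpha> * \<bar>t - s\<bar> powr \<alpha>"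
      using C by (simp add: mult_left_mono mult.assoc)
    also have "\<dots> \<le> K * \<bar>t - s\<bar> powr \<alpha>"
      using \<open>B \<ge> 0\<close> by (intro mult_right_mono) (auto simp: K_def)
    finally show ?thesis .
  next
    case False
    have "\<bar>w t - w s\<bar> \<le> 2 * B" using B[of s] B[of t] that by auto
    also have "\<dots> \<le> 2 * B * (2 ^ n0 * \<bar>t - s\<bar>) powr \<alpha>"
    proof -
      have "1 \<le> 2 ^ n0 * \<bar>t - s\<bar>" using False that by (simp add: field_simps)
      then have "1 \<le> (2 ^ n0 * \<bar>t - s\<bar>) powr \<alpha>" using \<alpha> by (intro ge_one_powr_ge_zero) auto
      then show ?thesis using \<open>B \<ge> 0\<close> by (auto simp: mult_le_cancel_left1)
    qed
    also have "\<dots> = 2 * B * (2 ^ n0) powr \<alpha> * \<bar>t - s\<bar> powr \<alpha>" by (simp add: powr_mult)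
    also have "\<dots> \<le> K * \<bar>t - s\<bar> powr \<alpha>" using C by (intro mult_right_mono) (auto simp: K_def)
    finally show ?thesis .
  qed
  show ?thesis
  proof (intro exI[of _ K] ballI)
    fix s t assume "s \<in> {0..real N}" "t \<in> {0..real N}"
    then show "\<bar>w t - w s\<bar> \<le> K * \<bar>t - s\<bar> powr \<alpha>"
      using ordered[of s t] ordered[of t s]
      by (cases s t rule: linorder_cases) (auto simp: abs_minus_commute)
  qed
qed

text \<open>A union bound over the \<open>N * 2 ^ n\<close> cells of level \<open>n\<close> and Markov's inequality for the
  \<open>p\<close>-th powers bound the probability that some increment at this level reaches \<open>r ^ n\<close> by a multiple
  of \<open>2 ^ n * (2 powr - n) powr (1 + \<beta>) / r ^ (n * p) = \<rho> ^ n\<close>, with \<open>\<rho> < 1\<close> exactly because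
  \<open>p * \<alpha> < \<beta>\<close>. By Borel and Cantelli almost every path satisfies the dyadic bounds from some level
  on. Continuity of the paths extends these bounds to all times, which is why the conclusion
  concerns \<open>X\<close> itself and not a modification of it.\<close>

lemma (in prob_space) kolmogorov_chentsov:
  fixes X :: "real \<Rightarrow> 'a \<Rightarrow> real" and p :: nat
  assumes meas: "\<And>t. t \<ge> 0 \<Longrightarrow> X t \<in> borel_measurable M"
    and int: "\<And>s t. 0 \<le> s \<Longrightarrow> s < t \<Longrightarrow> integrable M (\<lambda>\<omega>. \<bar>X t \<omega> - X s \<omega>\<bar> ^ p)"
    and moment: "\<And>s t. 0 \<le> s \<Longrightarrow> s < t \<Longrightarrow>
      expectation (\<lambda>\<omega>. \<bar>X t \<omega> - X s \<omega>\<bar> ^ p) \<le> C * (t - s) powr (1 + \<beta>)"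
    and cont: "AE \<omega> in M. continuous_on {0..} (\<lambda>t. X t \<omega>)"
    and \<alpha>: "\<alpha> > 0" "real p * \<alpha> < \<beta>"
  shows "AE \<omega> in M. \<forall>N. \<exists>K. \<forall>s\<in>{0..real N}. \<forall>t\<in>{0..real N}.
    \<bar>X t \<omega> - X s \<omega>\<bar> \<le> K * \<bar>t - s\<bar> powr \<alpha>"
proof -
  define r where "r = 2 powr - \<alpha>"
  have r: "r > 0" by (simp add: r_def)
  define \<Delta> where "\<Delta> n k \<omega> =
    \<bar>X (real (Suc k) / 2 ^ n) \<omega> - X (real k / 2 ^ n) \<omega>\<bar>" for n k :: nat and \<omega>
  have \<Delta>_meas [measurable]: "\<Delta> n k \<in> borel_measurable M" for n k
    unfolding \<Delta>_def using meas by measurable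
  define A where "A N n = (\<Union>k<N * 2 ^ n. {\<omega> \<in> space M. (r ^ n) ^ p \<le> \<Delta> n k \<omega> ^ p})" for N n :: nat
  have A_meas [measurable]: "A N n \<in> sets M" for N n unfolding A_def by measurable
  define \<rho> where "\<rho> = 2 powr (real p * \<alpha> - \<beta>)"
  have \<rho>: "0 < \<rho>" "\<rho> < 1" using \<alpha> by (auto simp: \<rho>_def powr_less_one)
  have \<rho>_power: "\<rho> ^ n = 2 powr ((real p * \<alpha> - \<beta>) * real n)" for n
    by (simp add: \<rho>_def powr_powr flip: powr_realpow)
  have r_power: "(r ^ n) ^ p = 2 powr (- real p * \<alpha> * real n)" for n
    by (simp add: r_def powr_powr mult_ac flip: powr_realpow)
  have markov: "prob {\<omega> \<in> space M. (r ^ n) ^ p \<le> \<Delta> n k \<omega> ^ p} \<le> C * \<rho> ^ n / 2 ^ n" for n k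
  proof -
    have le: "0 \<le> real k / 2 ^ n" "real k / 2 ^ n < real (Suc k) / 2 ^ n"
      by (auto simp: divide_strict_right_mono)
    have len: "real (Suc k) / 2 ^ n - real k / 2 ^ n = 2 powr - real n"
      by (simp add: powr_minus powr_realpow divide_simps)
    have pos: "0 < (r ^ n) ^ p" using r by simp
    have "prob {\<omega> \<in> space M. (r ^ n) ^ p \<le> \<Delta> n k \<omega> ^ p} \<le> expectation (\<lambda>\<omega>. \<Delta> n k \<omega> ^ p) / (r ^ n) ^ p"
      using int[OF le] pos unfolding \<Delta>_def
      by (intro integral_Markov_inequality_measure[where A = "space M"]) auto
    also have "\<dots> \<le> C * (2 powr - real n) powr (1 + \<beta>) / (r ^ n) ^ p"
      using moment[OF le] pos unfolding \<Delta>_def len by (intro divide_right_mono) auto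
    also have "\<dots> = C * 2 powr ((real p * \<alpha> - \<beta>) * real n - real n)"
      by (simp add: r_power powr_powr algebra_simps flip: powr_diff times_divide_eq_right)
    also have "\<dots> = C * \<rho> ^ n / 2 ^ n"
      by (simp add: \<rho>_power powr_diff[of 2 _ "real n"] powr_realpow)
    finally show ?thesis .
  qed
  have prob_A: "prob (A N n) \<le> real N * C * \<rho> ^ n" for N n
  proof -
    have "prob (A N n) \<le> (\<Sum>k<N * 2 ^ n. prob {\<omega> \<in> space M. (r ^ n) ^ p \<le> \<Delta> n k \<omega> ^ p})"
      unfolding A_def by (intro finite_measure_subadditive_finite) auto
    also have "\<dots> \<le> (\<Sum>k<N * 2 ^ n. C * \<rho> ^ n / 2 ^ n)" by (intro sum_mono markov)
    also have "\<dots> = real N * C * \<rho> ^ n" by simp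
    finally show ?thesis .
  qed
  have "AE \<omega> in M. eventually (\<lambda>n. \<omega> \<in> space M - A N n) sequentially" for N
  proof (rule borel_cantelli_AE1)
    show "summable (\<lambda>n. prob (A N n))"
    proof (rule summable_comparison_test')
      show "summable (\<lambda>n. real N * C * \<rho> ^ n)"
        using \<rho> by (intro summable_mult summable_geometric) auto
      show "norm (prob (A N n)) \<le> real N * C * \<rho> ^ n" for n using prob_A by simp
    qed
  qed (auto simp: emeasure_eq_measure)
  then have "AE \<omega> in M. \<forall>N. eventually (\<lambda>n. \<omega> \<in> space M - A N n) sequentially"
    by (simp add: AE_all_countable)
  with cont show ?thesis
  proof eventually_elim
    case (elim \<omega>)
    show ?case
    proof
      fix N
      obtain n0 where n0: "\<And>n. n \<ge> n0 \<Longrightarrow> \<omega> \<in> space M - A N n"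
        using elim(2) unfolding eventually_sequentially by meson
      show "\<exists>K. \<forall>s\<in>{0..real N}. \<forall>t\<in>{0..real N}. \<bar>X t \<omega> - X s \<omega>\<bar> \<le> K * \<bar>t - s\<bar> powr \<alpha>"
      proof (rule dyadic_increments_imp_holder[OF \<alpha>(1), of N _ n0])
        show "continuous_on {0..real N} (\<lambda>t. X t \<omega>)"
          using elim(1) by (rule continuous_on_subset) auto
        fix n k assume nk: "n \<ge> n0" "k < N * 2 ^ n"
        have "\<Delta> n k \<omega> ^ p < (r ^ n) ^ p" using n0[OF nk(1)] nk(2) by (force simp: A_def)
        then have "\<Delta> n k \<omega> < r ^ n" by (rule power_less_imp_less_base) (use r in auto)
        then show "\<bar>X (real (Suc k) / 2 ^ n) \<omega> - X (real k / 2 ^ n) \<omega>\<bar> \<le> (2 powr - \<alpha>) ^ n"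
          by (simp add: \<Delta>_def r_def)
      qed
    qed
  qed
qed

section \<open>Moments of Gaussian variables and fractional Brownian motion\<close>

lemma gaussian_rv_measurable: "gaussian_rv M X \<Longrightarrow> X \<in> borel_measurable M"
  unfolding gaussian_rv_def by (auto dest: distributed_measurable)

text \<open>For a centred Gaussian law all even moments are powers of the variance up to a combinatorial
  constant. This turns the variance of an increment, which the covariance of a process
  determines, into moment bounds of arbitrarily high order.\<close>

lemma (in prob_space)
  assumes "gaussian_rv M X"
  shows gaussian_rv_integrable_power: "integrable M (\<lambda>\<omega>. X \<omega> ^ n)"
    and gaussian_rv_even_moment: "expectation X = 0 \<Longrightarrow>
      expectation (\<lambda>\<omega>. X \<omega> ^ (2 * k)) = fact (2 * k) / (2 ^ k * fact k) * expectation (\<lambda>\<omega>. (X \<omega>)\<^sup>2) ^ k"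
proof -
  consider \<mu> s where "s > 0" "distributed M lborel X (\<lambda>x. ennreal (normal_density \<mu> s x))"
    | \<mu> where "X \<in> borel_measurable M" "AE \<omega> in M. X \<omega> = \<mu>"
    using assms unfolding gaussian_rv_def by blast
  then have "integrable M (\<lambda>\<omega>. X \<omega> ^ n) \<and> (expectation X = 0 \<longrightarrow>
      expectation (\<lambda>\<omega>. X \<omega> ^ (2 * k)) = fact (2 * k) / (2 ^ k * fact k) * expectation (\<lambda>\<omega>. (X \<omega>)\<^sup>2) ^ k)"
  proof cases
    case 1
    note D = 1(2)
    have moment: "expectation (\<lambda>\<omega>. (X \<omega> - \<mu>) ^ (2 * j)) = fact (2 * j) / ((2 / s\<^sup>2) ^ j * fact j)" for j
      using integral_normal_moment_even[OF 1(1), of \<mu> j]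
      by (subst distributed_integral[OF D, symmetric]) auto
    have central: "integrable M (\<lambda>\<omega>. (X \<omega> - \<mu>) ^ j)" for j
      using integrable_normal_moment[OF 1(1), of \<mu> j]
      by (subst distributed_integrable[OF D, symmetric]) auto
    \<comment> \<open>Expand \<open>X = (X - \<mu>) + \<mu>\<close>: the powers of \<open>X\<close> are combinations of central ones.\<close>
    have "integrable M (\<lambda>\<omega>. \<Sum>j\<le>n. of_nat (n choose j) * (X \<omega> - \<mu>) ^ j * \<mu> ^ (n - j))"
      by (intro Bochner_Integration.integrable_sum integrable_mult_left integrable_mult_right central)
    then have integrable: "integrable M (\<lambda>\<omega>. X \<omega> ^ n)"
      by (simp add: binomial_ring[symmetric])
    moreover have "expectation (\<lambda>\<omega>. X \<omega> ^ (2 * k))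
        = fact (2 * k) / (2 ^ k * fact k) * expectation (\<lambda>\<omega>. (X \<omega>)\<^sup>2) ^ k" if "expectation X = 0"
    proof -
      have "expectation X = \<mu>"
        using integral_normal_moment_nz_1[OF 1(1), of \<mu>]
        by (subst (asm) distributed_integral[OF D]) auto
      with that have "\<mu> = 0" by simp
      then show ?thesis using moment[of k] moment[of 1] 1(1) by (simp add: power_divide fact_numeral)
    qed
    ultimately show ?thesis by blast
  next
    case 2
    have [measurable]: "X \<in> borel_measurable M" by fact
    have const: "expectation (\<lambda>\<omega>. h (X \<omega>)) = h \<mu>" if [measurable]: "h \<in> borel_measurable borel"
      for h :: "real \<Rightarrow> real"
    proof -
      have "expectation (\<lambda>\<omega>. h (X \<omega>)) = expectation (\<lambda>\<omega>. h \<mu>)"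
        by (rule integral_cong_AE) (use 2(2) in auto)
      then show ?thesis by (simp add: prob_space)
    qed
    have "integrable M (\<lambda>\<omega>. X \<omega> ^ n)"
      by (subst integrable_cong_AE[where g = "\<lambda>\<omega>. \<mu> ^ n"]) (use 2(2) in auto)
    moreover have "expectation X = \<mu>" using const[of "\<lambda>x. x"] by simp
    moreover have "expectation (\<lambda>\<omega>. X \<omega> ^ (2 * k)) = \<mu> ^ (2 * k)" "expectation (\<lambda>\<omega>. (X \<omega>)\<^sup>2) = \<mu>\<^sup>2"
      using const[of "\<lambda>x. x ^ (2 * k)"] const[of "\<lambda>x. x\<^sup>2"] by auto
    ultimately show ?thesis by (cases "k = 0") (auto simp: power_0_left)
  qed
  then show "integrable M (\<lambda>\<omega>. X \<omega> ^ n)"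
    "expectation X = 0 \<Longrightarrow>
      expectation (\<lambda>\<omega>. X \<omega> ^ (2 * k)) = fact (2 * k) / (2 ^ k * fact k) * expectation (\<lambda>\<omega>. (X \<omega>)\<^sup>2) ^ k"
    by blast+
qed

lemma gaussian_process_rv: "gaussian_process M T X \<Longrightarrow> t \<in> T \<Longrightarrow> gaussian_rv M (X t)"
  unfolding gaussian_process_def
  by (drule spec[of _ "{t}"], drule spec[of _ "\<lambda>_. 1"]) auto

lemma gaussian_process_increment:
  assumes "gaussian_process M T X" "s \<in> T" "t \<in> T" "s \<noteq> t"
  shows "gaussian_rv M (\<lambda>\<omega>. X t \<omega> - X s \<omega>)"
  using assms(1)[unfolded gaussian_process_def, rule_format, of "{s, t}" "\<lambda>i. if i = t then 1 else - 1"] assms(2-)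
  by simp

lemma (in prob_space) fbm_increment:
  assumes fbm: "fractional_brownian_motion M H W" and st: "0 \<le> s" "s < t"
  shows "gaussian_rv M (\<lambda>\<omega>. W t \<omega> - W s \<omega>)"
    and "expectation (\<lambda>\<omega>. W t \<omega> - W s \<omega>) = 0"
    and "expectation (\<lambda>\<omega>. (W t \<omega> - W s \<omega>)\<^sup>2) = (t - s) powr (2 * H)"
proof -
  have gp: "gaussian_process M {0..} W"
    and mean: "\<And>t. t \<ge> 0 \<Longrightarrow> expectation (W t) = 0"
    and cov: "\<And>s t. 0 \<le> s \<Longrightarrow> 0 \<le> t \<Longrightarrow> expectation (\<lambda>\<omega>. W s \<omega> * W t \<omega>)
      = (s powr (2 * H) + t powr (2 * H) - \<bar>t - s\<bar> powr (2 * H)) / 2"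
    using fbm by (auto simp: fractional_brownian_motion_def)
  show g: "gaussian_rv M (\<lambda>\<omega>. W t \<omega> - W s \<omega>)"
    using gaussian_process_increment[OF gp] st by auto
  have g': "gaussian_rv M (W s)" "gaussian_rv M (W t)"
    using gaussian_process_rv[OF gp] st by auto
  have "integrable M (W s)" "integrable M (W t)"
    using g'[THEN gaussian_rv_integrable_power, of 1] by simp_all
  then show "expectation (\<lambda>\<omega>. W t \<omega> - W s \<omega>) = 0"
    using mean st by simp
  have sq: "integrable M (\<lambda>\<omega>. (W s \<omega>)\<^sup>2)" "integrable M (\<lambda>\<omega>. (W t \<omega>)\<^sup>2)"
    "integrable M (\<lambda>\<omega>. (W t \<omega> - W s \<omega>)\<^sup>2)"
    using g g' gaussian_rv_integrable_power by blast+
  \<comment> \<open>Polarization: it reduces the mixed moment, and its integrability, to squares of Gaussian variables.\<close>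
  have "expectation (\<lambda>\<omega>. W s \<omega> * W t \<omega>)
      = expectation (\<lambda>\<omega>. ((W s \<omega>)\<^sup>2 + (W t \<omega>)\<^sup>2 - (W t \<omega> - W s \<omega>)\<^sup>2) / 2)"
    by (intro Bochner_Integration.integral_cong) (auto simp: power2_eq_square algebra_simps)
  also have "\<dots> = (expectation (\<lambda>\<omega>. (W s \<omega>)\<^sup>2) + expectation (\<lambda>\<omega>. (W t \<omega>)\<^sup>2)
      - expectation (\<lambda>\<omega>. (W t \<omega> - W s \<omega>)\<^sup>2)) / 2"
    using sq by simp
  finally show "expectation (\<lambda>\<omega>. (W t \<omega> - W s \<omega>)\<^sup>2) = (t - s) powr (2 * H)"
    using cov[of s s] cov[of t t] cov[of s t] st by (simp add: power2_eq_square)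
qed

text \<open>Increments have variance \<open>(t - s) powr (2 * H)\<close>, hence \<open>2 * k\<close>-th moment of order
  \<open>(t - s) powr (2 * k * H)\<close>. The Kolmogorov-Chentsov criterion then yields every exponent below
  \<open>(2 * k * H - 1) / (2 * k) = H - 1 / (2 * k)\<close>, and \<open>k\<close> is arbitrary.\<close>

lemma (in prob_space) fbm_holder:
  assumes fbm: "fractional_brownian_motion M H W" and \<alpha>: "0 < \<alpha>" "\<alpha> < H"
  shows "AE \<omega> in M. \<forall>N. \<exists>K. \<forall>s\<in>{0..real N}. \<forall>t\<in>{0..real N}.
    \<bar>W t \<omega> - W s \<omega>\<bar> \<le> K * \<bar>t - s\<bar> powr \<alpha>"
proof -
  obtain k :: nat where k: "1 / (2 * (H - \<alpha>)) < real k" using reals_Archimedean2 by blast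
  then have k': "1 < 2 * real k * (H - \<alpha>)" using \<alpha> by (simp add: field_simps)
  define C :: real where "C = fact (2 * k) / (2 ^ k * fact k)"
  show ?thesis
  proof (rule kolmogorov_chentsov[where p = "2 * k" and C = C and \<beta> = "2 * real k * H - 1"])
    show "W t \<in> borel_measurable M" if "t \<ge> 0" for t
      using fbm that by (auto simp: fractional_brownian_motion_def
          intro!: gaussian_rv_measurable gaussian_process_rv[of M "{0..}"])
    fix s t :: real assume st: "0 \<le> s" "s < t"
    note incr = fbm_increment[OF fbm st]
    show "integrable M (\<lambda>\<omega>. \<bar>W t \<omega> - W s \<omega>\<bar> ^ (2 * k))"
      using gaussian_rv_integrable_power[OF incr(1)] by (simp add: power_even_abs)
    have "expectation (\<lambda>\<omega>. \<bar>W t \<omega> - W s \<omega>\<bar> ^ (2 * k)) = C * ((t - s) powr (2 * H)) ^ k"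
      using gaussian_rv_even_moment[OF incr(1,2), of k] incr(3) by (simp add: C_def power_even_abs)
    also have "((t - s) powr (2 * H)) ^ k = (t - s) powr (1 + (2 * real k * H - 1))"
      using st by (simp add: powr_powr mult_ac flip: powr_realpow)
    finally show "expectation (\<lambda>\<omega>. \<bar>W t \<omega> - W s \<omega>\<bar> ^ (2 * k))
      \<le> C * (t - s) powr (1 + (2 * real k * H - 1))" by simp
  next
    show "AE \<omega> in M. continuous_on {0..} (\<lambda>t. W t \<omega>)"
      using fbm by (simp add: fractional_brownian_motion_def)
    show "real (2 * k) * \<alpha> < 2 * real k * H - 1" using k' by (simp add: algebra_simps)
  qed (use \<alpha> in auto)
qed

section \<open>A singular drift keeps the path away from zero\<close>

text \<open>Suppose that \<open>z\<close> vanishes at \<open>T\<close> and put \<open>h = T - t\<close>. The drift is positive, so only the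
  noise can push \<open>z\<close> down to 0, and its Hoelder continuity gives \<open>z t \<le> L * h powr \<alpha>\<close>. The
  drift is then at least \<open>c / (L * h powr \<alpha>)\<close> on \<open>[t, T)\<close>, so over a time of order \<open>h\<close> it
  contributes at least an amount of order \<open>h powr (1 - \<alpha>)\<close>. But \<open>z\<close> and the noise both move by
  \<open>O(h powr \<alpha>)\<close> only, which for \<open>\<alpha> > 1 / 2\<close> is of smaller order as \<open>h\<close> tends to 0.\<close>

lemma singular_drift_excludes_zero:
  fixes z v b :: "real \<Rightarrow> real"
  assumes "a < T" and cont: "continuous_on {a..T} z"
    and pos: "\<And>t. a \<le> t \<Longrightarrow> t < T \<Longrightarrow> z t > 0"
    and eq: "\<And>t u. a \<le> t \<Longrightarrow> t \<le> u \<Longrightarrow> u < T \<Longrightarrow>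
      b integrable_on {t..u} \<and> z u - z t = integral {t..u} b + (v u - v t)"
    and drift: "\<And>t. a \<le> t \<Longrightarrow> t < T \<Longrightarrow> b t \<ge> c / z t" and c: "c > 0"
    and holder: "\<And>t u. a \<le> t \<Longrightarrow> t \<le> u \<Longrightarrow> u < T \<Longrightarrow> \<bar>v u - v t\<bar> \<le> K * (u - t) powr \<alpha>"
    and \<alpha>: "\<alpha> > 1 / 2"
  shows "z T \<noteq> 0"
proof
  assume zT: "z T = 0"
  define L where "L = \<bar>K\<bar> + 1"
  have L: "L > 0" by (simp add: L_def)
  have osc: "\<bar>v u - v t\<bar> \<le> L * (T - t) powr \<alpha>" if "a \<le> t" "t \<le> u" "u < T" for t u
  proof -
    have "\<bar>v u - v t\<bar> \<le> K * (u - t) powr \<alpha>" using holder that .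
    also have "\<dots> \<le> L * (u - t) powr \<alpha>" by (intro mult_right_mono) (auto simp: L_def)
    also have "\<dots> \<le> L * (T - t) powr \<alpha>"
      using that \<alpha> L by (intro mult_left_mono powr_mono2) auto
    finally show ?thesis .
  qed
  have int_nonneg: "integral {t..u} b \<ge> 0" if "a \<le> t" "t \<le> u" "u < T" for t u
  proof (rule integral_nonneg)
    show "b integrable_on {t..u}" using eq that by blast
    show "0 \<le> b s" if "s \<in> {t..u}" for s
    proof -
      have "a \<le> s" "s < T" using that \<open>a \<le> t\<close> \<open>u < T\<close> by auto
      then show ?thesis using drift[of s] pos[of s] c by (smt (verit) divide_pos_pos)
    qed
  qed
  have upper: "z t \<le> L * (T - t) powr \<alpha>" if t: "a \<le> t" "t < T" for t
  proof -
    have "(z \<longlongrightarrow> z T) (at T within {a..T})" using cont t by (auto simp: continuous_on)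
    then have "(z \<longlongrightarrow> 0) (at_left T)"
      using zT at_within_Icc_at_left[OF \<open>a < T\<close>] by simp
    then have "((\<lambda>u. z u + L * (T - t) powr \<alpha>) \<longlongrightarrow> 0 + L * (T - t) powr \<alpha>) (at_left T)"
      by (intro tendsto_intros)
    moreover have "eventually (\<lambda>u. z t \<le> z u + L * (T - t) powr \<alpha>) (at_left T)"
      using eventually_at_left_real[OF t(2)]
    proof eventually_elim
      case (elim u)
      then show ?case
        using eq[of t u] int_nonneg[of t u] osc[of t u] t by auto
    qed
    ultimately show ?thesis
      using tendsto_lowerbound[of _ _ _ "z t"] by force
  qed
  have lower: "c / (4 * L\<^sup>2) \<le> h powr (2 * \<alpha> - 1)" if h: "0 < h" "h \<le> T - a" for h
  proof -
    \<comment> \<open>The increment equation holds strictly before \<open>T\<close> only. Stopping half-way to \<open>T\<close> avoids a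
      second passage to the limit and costs a factor 2.\<close>
    define t u where "t = T - h" and "u = T - h / 2"
    have tu: "a \<le> t" "t \<le> u" "u < T" "t < T" "T - t = h" "u - t = h / 2" using h by (auto simp: t_def u_def)
    have hp: "h powr \<alpha> > 0" using h by simp
    have "b s \<ge> c / (L * h powr \<alpha>)" if "s \<in> {t..u}" for s
    proof -
      have s: "a \<le> s" "s < T" "T - s \<le> h" using that tu by auto
      have "z s \<le> L * (T - s) powr \<alpha>" using upper s by auto
      also have "\<dots> \<le> L * h powr \<alpha>" using s \<alpha> L by (intro mult_left_mono powr_mono2) auto
      finally have "c / (L * h powr \<alpha>) \<le> c / z s"
        using c pos[of s] s hp L by (intro divide_left_mono) auto
      then show ?thesis using drift[of s] s by linarith
    qed
    then have "integral {t..u} (\<lambda>s. c / (L * h powr \<alpha>)) \<le> integral {t..u} b"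
      using eq[of t u] tu by (intro integral_le) auto
    then have "c / (L * h powr \<alpha>) * (h / 2) \<le> integral {t..u} b"
      using tu by (simp add: mult.commute)
    also have "\<dots> \<le> z u + \<bar>v u - v t\<bar>" using eq[of t u] pos[of t] tu by auto
    also have "\<dots> \<le> L * (T - u) powr \<alpha> + L * h powr \<alpha>"
      using upper[of u] osc[of t u] tu by auto
    also have "(T - u) powr \<alpha> \<le> h powr \<alpha>" using \<alpha> h by (intro powr_mono2) (auto simp: u_def)
    finally have "c * h \<le> 4 * L\<^sup>2 * (h powr \<alpha> * h powr \<alpha>)"
      using L hp by (simp add: field_simps power2_eq_square)
    also have "h powr \<alpha> * h powr \<alpha> = h * h powr (2 * \<alpha> - 1)"
      using h by (simp add: powr_mult_base flip: powr_add)
    finally have "c \<le> 4 * L\<^sup>2 * h powr (2 * \<alpha> - 1)" using h by simp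
    then show ?thesis using L by (simp add: field_simps)
  qed
  have "((\<lambda>h. h powr (2 * \<alpha> - 1)) \<longlongrightarrow> 0 powr (2 * \<alpha> - 1)) (at_right 0)"
    using \<alpha> by (intro tendsto_powr' tendsto_intros) (auto simp: eventually_at_filter)
  moreover have "eventually (\<lambda>h. c / (4 * L\<^sup>2) \<le> h powr (2 * \<alpha> - 1)) (at_right 0)"
    using eventually_at_right_real[of 0 "T - a"] \<open>a < T\<close> by (auto elim!: eventually_mono intro!: lower)
  ultimately have "c / (4 * L\<^sup>2) \<le> 0"
    using tendsto_lowerbound[of _ _ _ "c / (4 * L\<^sup>2)"] by force
  then show False using c L by (simp add: field_simps)
qed


lemma hitting_time_zero_nonneg: "0 \<le> hitting_time_zero z"
  unfolding hitting_time_zero_def by (rule INF_greatest) auto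

text \<open>At a finite hitting time \<open>T\<close> the path is small just before \<open>T\<close>, and \<open>f T 0 > 0\<close>; by continuity
  \<open>f s (z s)\<close> stays above \<open>f T 0 / 2\<close> there, so the drift dominates a multiple of \<open>1 / z\<close>
  and the path cannot vanish at \<open>T\<close>.\<close>

lemma holder_noise_hitting_time_infinite:
  fixes f :: "real \<Rightarrow> real \<Rightarrow> real"
  assumes sol: "solves_until_zero f \<sigma> z0 w z" and z0: "z0 > 0"
    and f: "continuous_on ({0..} \<times> {0..}) (\<lambda>(t, x). f t x)" and D2: "condition_D2 f"
    and \<alpha>: "\<alpha> > 1 / 2"
    and holder: "\<And>N :: nat. \<exists>K. \<forall>s\<in>{0..real N}. \<forall>t\<in>{0..real N}. \<bar>w t - w s\<bar> \<le> K * \<bar>t - s\<bar> powr \<alpha>"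
  shows "hitting_time_zero z = \<infinity>"
proof (rule ccontr)
  assume "hitting_time_zero z \<noteq> \<infinity>"
  then obtain T where T: "hitting_time_zero z = ereal T" "T \<ge> 0"
    using hitting_time_zero_nonneg[of z] by (cases "hitting_time_zero z") auto
  have "z 0 = z0" and zT: "z T = 0"
    and "continuous_on {t. 0 \<le> t \<and> t \<le> T} z"
    and pos: "\<And>t. 0 \<le> t \<Longrightarrow> t < T \<Longrightarrow> z t > 0"
    and eq: "\<And>t. 0 \<le> t \<Longrightarrow> t < T \<Longrightarrow>
      z t = z0 + 1 / 2 * integral {0..t} (\<lambda>s. f s (z s) / z s) + \<sigma> / 2 * w t"
    using sol
    unfolding solves_until_zero_def Let_def T(1) ereal_less_eq(3) less_ereal.simps(1) ereal.inject
    by blast+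
  then have cont: "continuous_on {0..T} z"
    by (simp add: atLeastAtMost_def atLeast_def atMost_def Collect_conj_eq)
  \<comment> \<open>Positivity of \<open>T\<close> matters: (D2) says nothing about the sign of \<open>f\<close> at time 0.\<close>
  have "T > 0" using \<open>z 0 = z0\<close> zT z0 T(2) by (cases "T = 0") auto
  have cont_f: "continuous_on {0..T} (\<lambda>s. f s (z s))"
  proof -
    have "z s \<ge> 0" if "s \<in> {0..T}" for s
      using pos[of s] zT that by (cases "s = T") auto
    then have sub: "(\<lambda>s. (s, z s)) ` {0..T} \<subseteq> {0..} \<times> {0..}" by auto
    have "continuous_on {0..T} (\<lambda>s. (s, z s))" by (intro continuous_intros cont)
    from continuous_on_compose2[OF f this sub] show ?thesis by simp
  qed
  define c where "c = f T 0 / 2"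
  have "c > 0" using D2 \<open>T > 0\<close> unfolding condition_D2_def c_def
    by (metis half_gt_zero order_refl order_less_imp_le)
  have "((\<lambda>s. f s (z s)) \<longlongrightarrow> f T 0) (at_left T)"
    using cont_f[unfolded continuous_on, THEN bspec, of T] zT \<open>T > 0\<close>
    by (simp add: at_within_Icc_at_left)
  then have "eventually (\<lambda>s. f s (z s) > c) (at_left T)"
    using \<open>c > 0\<close> by (intro order_tendstoD) (auto simp: c_def)
  then obtain b where b: "b < T" "\<And>s. b < s \<Longrightarrow> s < T \<Longrightarrow> f s (z s) > c"
    unfolding eventually_at_left_field by auto
  define a where "a = max 0 ((b + T) / 2)"
  have a: "0 \<le> a" "b < a" "a < T" using b(1) \<open>T > 0\<close> by (auto simp: a_def max_def)
  obtain N :: nat where N: "T < real N" using reals_Archimedean2 by blast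
  obtain K where K: "\<And>s t. s \<in> {0..real N} \<Longrightarrow> t \<in> {0..real N} \<Longrightarrow> \<bar>w t - w s\<bar> \<le> K * \<bar>t - s\<bar> powr \<alpha>"
    using holder by blast
  let ?b = "\<lambda>s. f s (z s) / z s / 2"
  have int: "?b integrable_on {t..u}" if "0 \<le> t" "u < T" for t u
    using that pos by (intro integrable_continuous_real continuous_intros
        continuous_on_subset[OF cont_f] continuous_on_subset[OF cont]) (auto simp: less_imp_neq[THEN not_sym])
  have "z T \<noteq> 0"
  proof (rule singular_drift_excludes_zero[where z = z and a = a and T = T and b = ?b
        and v = "\<lambda>t. \<sigma> / 2 * w t" and \<alpha> = \<alpha> and K = "\<bar>\<sigma>\<bar> / 2 * K" and c = "c / 2"])
    show "continuous_on {a..T} z" using cont by (rule continuous_on_subset) (use a in auto)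
    show "z t > 0" if "a \<le> t" "t < T" for t using pos that a by auto
    show "?b integrable_on {t..u} \<and> z u - z t = integral {t..u} ?b + (\<sigma> / 2 * w u - \<sigma> / 2 * w t)"
      if "a \<le> t" "t \<le> u" "u < T" for t u
    proof -
      have half: "integral {0..x} ?b = 1 / 2 * integral {0..x} (\<lambda>s. f s (z s) / z s)" for x
        by (simp only: integral_divide)
      have "integral {0..t} ?b + integral {t..u} ?b = integral {0..u} ?b"
        using that a by (intro Henstock_Kurzweil_Integration.integral_combine int) auto
      moreover have "z t = z0 + integral {0..t} ?b + \<sigma> / 2 * w t"
        "z u = z0 + integral {0..u} ?b + \<sigma> / 2 * w u"
        unfolding half using that a by (intro eq; linarith)+
      ultimately show ?thesis using int[of t u] that a by linarith
    qed
    show "?b t \<ge> c / 2 / z t" if "a \<le> t" "t < T" for t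
      using b(2)[of t] pos[of t] that a by (auto simp: field_simps)
    show "\<bar>\<sigma> / 2 * w u - \<sigma> / 2 * w t\<bar> \<le> \<bar>\<sigma>\<bar> / 2 * K * (u - t) powr \<alpha>"
      if "a \<le> t" "t \<le> u" "u < T" for t u
    proof -
      have "\<bar>\<sigma> / 2 * w u - \<sigma> / 2 * w t\<bar> = \<bar>\<sigma>\<bar> / 2 * \<bar>w u - w t\<bar>"
        unfolding right_diff_distrib[symmetric] abs_mult by simp
      also have "\<dots> \<le> \<bar>\<sigma>\<bar> / 2 * (K * \<bar>u - t\<bar> powr \<alpha>)"
        using that a N by (intro mult_left_mono K) auto
      finally show ?thesis using that by (simp add: mult.assoc)
    qed
  qed (use a \<open>c > 0\<close> \<alpha> in auto)
  with zT show False by simp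
qed

section \<open>Positivity for Hurst parameter above one half\<close>

theorem theorem4p1:
  fixes M :: "'a measure"
    and H \<sigma> Z0 :: real
    and f :: "real \<Rightarrow> real \<Rightarrow> real"
    and W Z :: "real \<Rightarrow> 'a \<Rightarrow> real"
  assumes "prob_space M"
    and "1 / 2 < H" and "H < 1"
    and "\<sigma> > 0" and "Z0 > 0"
    and "fractional_brownian_motion M H W"
    and "continuous_on ({0..} \<times> {0..}) (\<lambda>(t, x). f t x)"
    and "condition_D1 f"
    and "condition_D2 f"
    and "AE \<omega> in M. solves_until_zero f \<sigma> Z0 (\<lambda>t. W t \<omega>) (\<lambda>t. Z t \<omega>)"
  shows "(AE \<omega> in M. \<forall>t\<ge>0. Z t \<omega> > 0) \<and>
         measure (completion M) {\<omega> \<in> space M. hitting_time_zero (\<lambda>t. Z t \<omega>) = \<infinity>} = 1"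
proof -
  interpret prob_space M by fact
  obtain \<alpha> where \<alpha>: "1 / 2 < \<alpha>" "\<alpha> < H" using dense[OF \<open>1 / 2 < H\<close>] by blast
  have "AE \<omega> in M. \<forall>N. \<exists>K. \<forall>s\<in>{0..real N}. \<forall>t\<in>{0..real N}.
      \<bar>W t \<omega> - W s \<omega>\<bar> \<le> K * \<bar>t - s\<bar> powr \<alpha>"
    using \<alpha> by (intro fbm_holder[OF assms(6)]) auto
  with assms(10) have never: "AE \<omega> in M. hitting_time_zero (\<lambda>t. Z t \<omega>) = \<infinity>"
  proof eventually_elim
    case (elim \<omega>)
    show ?case
      by (rule holder_noise_hitting_time_infinite[OF elim(1) \<open>Z0 > 0\<close> assms(7,9) \<alpha>(1)])
        (use elim(2) in blast)
  qed
  from assms(10) never have "AE \<omega> in M. \<forall>t\<ge>0. Z t \<omega> > 0"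
  proof eventually_elim
    case (elim \<omega>)
    from elim(1) have "\<forall>t\<ge>0. ereal t < hitting_time_zero (\<lambda>t. Z t \<omega>) \<longrightarrow> Z t \<omega> > 0"
      unfolding solves_until_zero_def Let_def by blast
    with elim(2) show ?case by simp
  qed
  moreover have "measure (completion M) {\<omega> \<in> space M. hitting_time_zero (\<lambda>t. Z t \<omega>) = \<infinity>} = 1"
  proof -
    \<comment> \<open>The event need not be measurable in \<open>M\<close>, since \<open>Z\<close> is an arbitrary family of functions; it
      contains a set of full measure, and so it is an event of the completion.\<close>
    interpret c: prob_space "completion M" by (rule prob_space_completion)
    have "Measurable.pred (completion M) (\<lambda>\<omega>. hitting_time_zero (\<lambda>t. Z t \<omega>) \<noteq> \<infinity>)"
      using never by (intro sets_completion_AE) simp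
    then have "Measurable.pred (completion M) (\<lambda>\<omega>. \<not> hitting_time_zero (\<lambda>t. Z t \<omega>) \<noteq> \<infinity>)"
      by (rule pred_intros_logic)
    then have "{\<omega> \<in> space (completion M). hitting_time_zero (\<lambda>t. Z t \<omega>) = \<infinity>} \<in> sets (completion M)"
      by (simp add: pred_def)
    then show ?thesis
      using c.prob_Collect_eq_1 AE_completion[OF never] by simp
  qed
  ultimately show ?thesis ..
qed

end
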